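(* Let $G$ be an infinite FC-group with finitely many automorphism orbits. Then the derived subgroup $G'$ is finite. Moreover, $G$ admits a decomposition $G = \mathrm{Tor}(G) \times D$, where $D$ is a divisible characteristic subgroup of $Z(G)$.
   Context: A group $G$ is an FC-group if every element of $G$ has only finitely many conjugates in $G$. The automorphism orbits of $G$ are the orbits of the natural action of $\mathrm{Aut}(G)$ on $G$. $Z(G)$ denotes the center of $G$ and $G'$ its derived (commutator) subgroup. $\mathrm{Tor}(G)$ denotes the set of all elements of finite order in $G$ (which is a subgroup when $G$ is an FC-group). *)

theory Defs
  imports "HOL-Algebra.Algebra"
begin

locale fc_group = group +
  assumes finite_conjugates:
    "x \<in> carrier G \<Longrightarrow> finite (orbit G (\<lambda>g. \<lambda>h \<in> carrier G. g \<otimes> h \<otimes> inv g) x)"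

definition center :: "('a, 'b) monoid_scheme \<Rightarrow> 'a set" where
  "center G = {z \<in> carrier G. \<forall>x \<in> carrier G. z \<otimes>\<^bsub>G\<^esub> x = x \<otimes>\<^bsub>G\<^esub> z}"

definition Tor :: "('a, 'b) monoid_scheme \<Rightarrow> 'a set" where
  "Tor G = {x \<in> carrier G. \<exists>n::nat. n > 0 \<and> x [^]\<^bsub>G\<^esub> n = \<one>\<^bsub>G\<^esub>}"

definition automorphism_orbits :: "('a, 'b) monoid_scheme \<Rightarrow> 'a set set" where
  "automorphism_orbits G = orbits (AutoGroup G) (carrier G) (\<lambda>\<phi>. \<phi>)"

definition characteristic_subgroup :: "'a set \<Rightarrow> ('a, 'b) monoid_scheme \<Rightarrow> bool" where
  "characteristic_subgroup H G \<longleftrightarrow> subgroup H G \<and> (\<forall>\<phi> \<in> auto G. \<phi> ` H = H)"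

definition divisible :: "('a, 'b) monoid_scheme \<Rightarrow> bool" where
  "divisible G \<longleftrightarrow>
     (\<forall>n::nat. n > 0 \<longrightarrow> (\<forall>x \<in> carrier G. \<exists>y \<in> carrier G. y [^]\<^bsub>G\<^esub> n = x))"

definition internal_direct_product ::
    "('a, 'b) monoid_scheme \<Rightarrow> 'a set \<Rightarrow> 'a set \<Rightarrow> bool" where
  "internal_direct_product G H K \<longleftrightarrow>
     H \<lhd> G \<and> K \<lhd> G \<and> H \<inter> K = {\<one>\<^bsub>G\<^esub>} \<and> H <#>\<^bsub>G\<^esub> K = carrier G"

lemma (in group) AutoGroup_action: "group_action (AutoGroup G) (carrier G) (\<lambda>\<phi>. \<phi>)"
proof -
  have "subgroup (auto G) (BijGroup (carrier G))"
    by (rule subgroup_auto)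
  then have "(\<lambda>\<phi>. \<phi>) \<in> hom (AutoGroup G) (BijGroup (carrier G))"
    by (auto simp: hom_def AutoGroup_def dest: subgroup.mem_carrier)
  then show ?thesis
    by (simp add: group_action_def group_hom_def group_hom_axioms_def AutoGroup group_BijGroup)
qed

lemma (in group) center_subgroup: "subgroup (center G) G"
proof (rule subgroupI)
  show "center G \<subseteq> carrier G"
    by (auto simp: center_def)
  have "\<one> \<in> center G"
    by (simp add: center_def)
  then show "center G \<noteq> {}" by blast
next
  fix a assume a: "a \<in> center G"
  then have ac: "a \<in> carrier G" by (simp add: center_def)
  have "inv a \<otimes> x = x \<otimes> inv a" if x: "x \<in> carrier G" for x
  proof -
    have "a \<otimes> inv x = inv x \<otimes> a" using a x by (simp add: center_def)
    then have "inv (a \<otimes> inv x) = inv (inv x \<otimes> a)" by (rule arg_cong)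
    then show ?thesis using ac x by (simp add: inv_mult_group)
  qed
  then show "inv a \<in> center G" using ac by (simp add: center_def)
next
  fix a b assume a: "a \<in> center G" and b: "b \<in> center G"
  then have ab: "a \<in> carrier G" "b \<in> carrier G" by (simp_all add: center_def)
  have "a \<otimes> b \<otimes> x = x \<otimes> (a \<otimes> b)" if x: "x \<in> carrier G" for x
  proof -
    have "a \<otimes> b \<otimes> x = a \<otimes> (b \<otimes> x)" using ab x by (rule m_assoc)
    also have "b \<otimes> x = x \<otimes> b" using b x by (simp add: center_def)
    also have "a \<otimes> (x \<otimes> b) = a \<otimes> x \<otimes> b" using ab x by (simp add: m_assoc)
    also have "a \<otimes> x = x \<otimes> a" using a x by (simp add: center_def)
    also have "x \<otimes> a \<otimes> b = x \<otimes> (a \<otimes> b)" using ab x by (simp add: m_assoc)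
    finally show ?thesis .
  qed
  then show "a \<otimes> b \<in> center G" using ab by (simp add: center_def)
qed

end

theory Submission
  imports Defs
begin

text \<open>
  Automorphisms preserve every property that is defined in terms of the group structure, so finitely
  many automorphism orbits make all such data uniform (lemma \<open>uniform_multiple\<close>). This is
  used for three kinds of data: the sizes of the conjugacy classes are bounded, the torsion elements
  have a common exponent, and the central elements that fail to be \<open>n\<close>-th powers of central
  elements for some \<open>n\<close> fail for some divisor of one fixed number.

  Bounded conjugacy classes force \<open>G'\<close> to be finite (B. H. Neumann). The proof below is
  elementary. Looking at an element with a largest conjugacy class shows that there are only
  finitely many commutators (\<open>finite_commutators\<close>). On the other hand, a centralizer of
  bounded index contains a bounded power of every element, so some fixed power of every element is
  central (\<open>uniform_central_power\<close>). These two facts give the finiteness of \<open>G'\<close>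
  by Schur's rewriting argument (\<open>finite_derived\<close>): a long product of commutators repeats a
  factor often enough to be replaced by a shorter product.

  Once \<open>G'\<close> is finite, the torsion elements form a subgroup, because modulo \<open>G'\<close>
  powers are multiplicative. The complement \<open>D\<close> consists of the central elements that have,
  for every \<open>n > 0\<close>, an \<open>n\<close>-th root in the center. By uniformity there is one
  \<open>k > 0\<close> such that every \<open>k\<close>-th power of a central element already lies in
  \<open>D\<close>. Hence \<open>D\<close> is divisible; it is torsion-free because an
  \<open>e\<close>-th power of a torsion element is trivial when \<open>e\<close> is the common exponent.
  Finally \<open>g\<^sup>M \<in> D\<close> for some \<open>M > 0\<close>; dividing \<open>g\<close> by an
  \<open>M\<close>-th root of this element in \<open>D\<close> leaves a torsion element.
\<close>

section \<open>Uniformity from finitely many automorphism orbits\<close>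

definition conj_class :: "('a, 'b) monoid_scheme \<Rightarrow> 'a \<Rightarrow> 'a set" where
  "conj_class G x = (\<lambda>g. g \<otimes>\<^bsub>G\<^esub> x \<otimes>\<^bsub>G\<^esub> inv\<^bsub>G\<^esub> g) ` carrier G"

definition commutator :: "('a, 'b) monoid_scheme \<Rightarrow> 'a \<Rightarrow> 'a \<Rightarrow> 'a" where
  "commutator G x y = x \<otimes>\<^bsub>G\<^esub> y \<otimes>\<^bsub>G\<^esub> inv\<^bsub>G\<^esub> x \<otimes>\<^bsub>G\<^esub> inv\<^bsub>G\<^esub> y"

definition divisible_center :: "('a, 'b) monoid_scheme \<Rightarrow> 'a set" where
  "divisible_center G =
     {z \<in> center G. \<forall>n::nat. n > 0 \<longrightarrow> (\<exists>y \<in> center G. z = y [^]\<^bsub>G\<^esub> n)}"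

context group
begin

lemma cancel_inv:
  assumes "x \<in> carrier G" "y \<in> carrier G"
  shows "inv x \<otimes> (x \<otimes> y) = y" "x \<otimes> (inv x \<otimes> y) = y"
  using assms by (simp_all flip: m_assoc)

lemma auto_group_hom:
  assumes "\<phi> \<in> auto G"
  shows "group_hom G G \<phi>"
  using assms is_group by (auto simp: auto_def group_hom_def group_hom_axioms_def)

lemma auto_bij_betw:
  assumes "\<phi> \<in> auto G"
  shows "bij_betw \<phi> (carrier G) (carrier G)"
  using assms by (auto simp: auto_def Bij_def)

text \<open>
  Each orbit has its own witness \<open>n\<close>, valid for all elements of the orbit, and the product
  of the finitely many witnesses is a multiple of all of them.
\<close>

lemma uniform_multiple:
  fixes P :: "'a \<Rightarrow> nat \<Rightarrow> bool"
  assumes fin: "finite (automorphism_orbits G)"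
    and inv: "\<And>\<phi> x n. \<phi> \<in> auto G \<Longrightarrow> x \<in> carrier G \<Longrightarrow> P x n \<Longrightarrow> P (\<phi> x) n"
  shows "\<exists>e>0. \<forall>x\<in>carrier G. \<forall>n>0. P x n \<longrightarrow> (\<exists>k>0. P x k \<and> k dvd e)"
proof -
  define Q where "Q U n \<longleftrightarrow> n > 0 \<and> (\<forall>y\<in>U. P y n)" for U n
  \<comment> \<open>An orbit without a witness contributes the neutral factor 1.\<close>
  define w where "w U = (if \<exists>n. Q U n then SOME n. Q U n else 1)" for U
  have w: "Q U (w U)" if "Q U n" for U n
    using that someI[of "Q U" n] by (auto simp: w_def)
  have wpos: "w U > 0" for U
  proof (cases "\<exists>n. Q U n")
    case True
    then show ?thesis using w Q_def by blast
  qed (simp add: w_def)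
  define e where "e = (\<Prod>U\<in>automorphism_orbits G. w U)"
  show ?thesis
  proof (rule exI[of _ e], intro conjI ballI allI impI)
    show "e > 0" using wpos by (simp add: e_def prod_pos)
  next
    fix x n assume x: "x \<in> carrier G" and n: "n > 0" and P: "P x n"
    let ?U = "orbit (AutoGroup G) (\<lambda>\<phi>. \<phi>) x"
    have U: "?U \<in> automorphism_orbits G"
      using x by (auto simp: automorphism_orbits_def orbits_def)
    have "Q ?U n"
      using x n P inv by (auto simp: Q_def orbit_def AutoGroup_def)
    then have "Q ?U (w ?U)" by (rule w)
    moreover have "x \<in> ?U"
      using x by (rule group_action.orbit_refl[OF AutoGroup_action])
    ultimately have "P x (w ?U)" by (simp add: Q_def)
    moreover have "w ?U dvd e"
      unfolding e_def using fin U by (rule dvd_prodI)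
    ultimately show "\<exists>k>0. P x k \<and> k dvd e" using wpos by blast
  qed
qed

lemma conj_class_closed: "x \<in> carrier G \<Longrightarrow> conj_class G x \<subseteq> carrier G"
  by (auto simp: conj_class_def)

lemma conj_class_conj:
  assumes "x \<in> carrier G" "g \<in> carrier G" "y \<in> conj_class G x"
  shows "g \<otimes> y \<otimes> inv g \<in> conj_class G x"
proof -
  obtain h where h: "h \<in> carrier G" "y = h \<otimes> x \<otimes> inv h"
    using assms by (auto simp: conj_class_def)
  then have "g \<otimes> y \<otimes> inv g = (g \<otimes> h) \<otimes> x \<otimes> inv (g \<otimes> h)"
    using assms by (simp add: inv_mult_group m_assoc)
  then show ?thesis using assms h by (auto simp: conj_class_def)
qed

lemma card_conj_class_auto:
  assumes "\<phi> \<in> auto G" "x \<in> carrier G"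
  shows "card (conj_class G (\<phi> x)) = card (conj_class G x)"
proof -
  interpret \<phi>: group_hom G G \<phi> using assms(1) by (rule auto_group_hom)
  have b: "bij_betw \<phi> (carrier G) (carrier G)" using assms(1) by (rule auto_bij_betw)
  have "conj_class G (\<phi> x) = (\<lambda>g. g \<otimes> \<phi> x \<otimes> inv g) ` \<phi> ` carrier G"
    using b by (simp add: conj_class_def bij_betw_imp_surj_on)
  also have "\<dots> = \<phi> ` conj_class G x"
    unfolding conj_class_def image_image using assms by (intro image_cong) simp_all
  finally show ?thesis
    using b conj_class_closed[OF assms(2)]
    by (metis bij_betw_imp_inj_on card_image inj_on_subset)
qed

section \<open>Finitely many commutators\<close>

lemma commutator_closed [simp]:
  assumes "x \<in> carrier G" "y \<in> carrier G"
  shows "commutator G x y \<in> carrier G"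
  using assms by (simp add: commutator_def)

text \<open>
  The centralizer of a finite set has finite index, since the coset of \<open>g\<close> is determined by
  the finitely many conjugates of the elements of the set by \<open>g\<close>.
\<close>

lemma finite_transversal_of_centralizer:
  assumes fin: "\<And>x. x \<in> carrier G \<Longrightarrow> finite (conj_class G x)"
    and B: "finite B" "B \<subseteq> carrier G"
  obtains T where "finite T" "T \<subseteq> carrier G"
    and "\<And>g. g \<in> carrier G \<Longrightarrow> \<exists>t\<in>T. \<exists>x\<in>carrier G. g = t \<otimes> x \<and> (\<forall>b\<in>B. x \<otimes> b = b \<otimes> x)"
proof -
  define F where "F g = (\<lambda>b\<in>B. g \<otimes> b \<otimes> inv g)" for g
  have "F ` carrier G \<subseteq> (\<Pi>\<^sub>E b\<in>B. conj_class G b)"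
    by (auto simp: F_def conj_class_def)
  moreover have "finite (\<Pi>\<^sub>E b\<in>B. conj_class G b)"
    using B fin by (intro finite_PiE) auto
  ultimately have "finite (F ` carrier G)" by (rule finite_subset)
  then obtain T where T: "T \<subseteq> carrier G" "finite T" "F ` carrier G = F ` T"
    using finite_subset_image[of "F ` carrier G" F "carrier G"] by auto
  show ?thesis
  proof (rule that[OF T(2,1)])
    fix g assume g: "g \<in> carrier G"
    then obtain t where t: "t \<in> T" "F g = F t" using T by (metis image_iff)
    have tc: "t \<in> carrier G" using t T by auto
    have "(inv t \<otimes> g) \<otimes> b = b \<otimes> (inv t \<otimes> g)" if b: "b \<in> B" for b
    proof -
      have bc: "b \<in> carrier G" using b B by auto
      have "g \<otimes> b \<otimes> inv g = t \<otimes> b \<otimes> inv t"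
        using fun_cong[OF t(2), of b] b by (simp add: F_def)
      then have "inv t \<otimes> (g \<otimes> b \<otimes> inv g) \<otimes> g = inv t \<otimes> (t \<otimes> b \<otimes> inv t) \<otimes> g" by simp
      then show ?thesis using g tc bc by (simp add: m_assoc cancel_inv)
    qed
    moreover have "g = t \<otimes> (inv t \<otimes> g)" using g tc by (simp add: cancel_inv)
    ultimately show "\<exists>t\<in>T. \<exists>x\<in>carrier G. g = t \<otimes> x \<and> (\<forall>b\<in>B. x \<otimes> b = b \<otimes> x)"
      using t(1) tc g by (metis inv_closed m_closed)
  qed
qed

text \<open>
  Let \<open>a\<close> have a conjugacy class \<open>A\<close> of maximal size and let \<open>B\<close> be a
  finite set that conjugates \<open>a\<close> to every element of \<open>A\<close>. If \<open>x\<close>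
  commutes with \<open>B\<close>, then conjugating \<open>x a\<close> by \<open>B\<close> gives all of
  \<open>x A\<close>, which by maximality is the whole class of \<open>x a\<close>. So
  \<open>y x a y\<^sup>-\<^sup>1 \<in> x A\<close> for every \<open>y\<close>, which puts the commutator of
  \<open>y\<close> and \<open>x\<close> in the set of quotients of elements of \<open>A\<close>. A general
  element differs from such an \<open>x\<close> by one of finitely many coset representatives.
\<close>

lemma finite_commutators:
  assumes fin: "\<And>x. x \<in> carrier G \<Longrightarrow> finite (conj_class G x)"
    and bound: "\<And>x. x \<in> carrier G \<Longrightarrow> card (conj_class G x) \<le> m"
  shows "finite {commutator G x y | x y. x \<in> carrier G \<and> y \<in> carrier G}"
proof -
  obtain a where a: "a \<in> carrier G"
    and max: "\<And>x. x \<in> carrier G \<Longrightarrow> card (conj_class G x) \<le> card (conj_class G a)"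
    using ex_has_greatest_nat[of "\<lambda>x. x \<in> carrier G" \<one> "\<lambda>x. card (conj_class G x)" "Suc m"] bound
    by (auto simp: less_Suc_eq_le)
  define A where "A = conj_class G a"
  have A: "A \<subseteq> carrier G" "finite A" using a fin conj_class_closed by (auto simp: A_def)
  obtain B where B: "B \<subseteq> carrier G" "finite B" "A = (\<lambda>g. g \<otimes> a \<otimes> inv g) ` B"
    using finite_subset_image[OF A(2), of "\<lambda>g. g \<otimes> a \<otimes> inv g" "carrier G"]
    by (auto simp: A_def conj_class_def)
  have centralizing: "\<exists>p\<in>A. \<exists>q\<in>A. commutator G y x = p \<otimes> inv q"
    if x: "x \<in> carrier G" and xB: "\<forall>b\<in>B. x \<otimes> b = b \<otimes> x" and y: "y \<in> carrier G" for x y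
  proof -
    have "(\<otimes>) x ` A \<subseteq> conj_class G (x \<otimes> a)"
    proof clarify
      fix p assume "p \<in> A"
      then obtain b where b: "b \<in> B" "p = b \<otimes> a \<otimes> inv b" using B by auto
      have bc: "b \<in> carrier G" using b B by auto
      have "x \<otimes> p = (x \<otimes> b) \<otimes> a \<otimes> inv b" using b bc x a by (simp add: m_assoc)
      also have "\<dots> = b \<otimes> (x \<otimes> a) \<otimes> inv b" using xB b bc x a by (simp add: m_assoc)
      finally show "x \<otimes> p \<in> conj_class G (x \<otimes> a)" using bc by (auto simp: conj_class_def)
    qed
    moreover have "card ((\<otimes>) x ` A) = card A"
      using A x by (intro card_image inj_onI) (auto simp: subset_iff)
    moreover have "card (conj_class G (x \<otimes> a)) \<le> card A" using max x a by (simp add: A_def)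
    ultimately have eq: "(\<otimes>) x ` A = conj_class G (x \<otimes> a)"
      using fin x a by (intro card_seteq) auto
    have "y \<otimes> (x \<otimes> a) \<otimes> inv y \<in> (\<otimes>) x ` A"
      unfolding eq using y by (auto simp: conj_class_def)
    then obtain p where p: "p \<in> A" "y \<otimes> (x \<otimes> a) \<otimes> inv y = x \<otimes> p" by auto
    define q where "q = y \<otimes> a \<otimes> inv y"
    have q: "q \<in> A" using y by (auto simp: q_def A_def conj_class_def)
    have pq: "p \<in> carrier G" "q \<in> carrier G" using p q A by auto
    have "(y \<otimes> x \<otimes> inv y) \<otimes> q = x \<otimes> p"
      using p(2) x y a by (simp add: q_def m_assoc cancel_inv)
    then have "y \<otimes> x \<otimes> inv y = x \<otimes> p \<otimes> inv q"
      using pq x y by (simp add: inv_solve_right)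
    then have "commutator G y x = x \<otimes> p \<otimes> inv q \<otimes> inv x" by (simp add: commutator_def)
    also have "\<dots> = (x \<otimes> p \<otimes> inv x) \<otimes> inv (x \<otimes> q \<otimes> inv x)"
      using pq x by (simp add: inv_mult_group m_assoc cancel_inv)
    finally show ?thesis
      using conj_class_conj[OF a x] p q by (auto simp: A_def)
  qed
  obtain T where T: "finite T" "T \<subseteq> carrier G"
    and T_cover: "\<And>g. g \<in> carrier G \<Longrightarrow> \<exists>t\<in>T. \<exists>x\<in>carrier G. g = t \<otimes> x \<and> (\<forall>b\<in>B. x \<otimes> b = b \<otimes> x)"
    using finite_transversal_of_centralizer[OF fin B(2,1)] by blast
  define S where
    "S = (\<Union>t\<in>T. (\<lambda>(u, p, q). u \<otimes> inv t \<otimes> (p \<otimes> inv q)) ` (conj_class G t \<times> A \<times> A))"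
  have "finite S" unfolding S_def using T A fin by auto
  moreover have "commutator G y g \<in> S" if y: "y \<in> carrier G" and g: "g \<in> carrier G" for y g
  proof -
    obtain t x where t: "t \<in> T" "t \<in> carrier G" and x: "x \<in> carrier G" "\<forall>b\<in>B. x \<otimes> b = b \<otimes> x"
      and gtx: "g = t \<otimes> x"
      using T_cover[OF g] T by blast
    obtain p q where pq: "p \<in> A" "q \<in> A" "commutator G y x = p \<otimes> inv q"
      using centralizing[OF x y] by auto
    have pqc: "p \<in> carrier G" "q \<in> carrier G" using pq A by auto
    define p' q' where "p' = t \<otimes> p \<otimes> inv t" and "q' = t \<otimes> q \<otimes> inv t"
    have p'q': "p' \<in> A" "q' \<in> A"
      using conj_class_conj[OF a t(2)] pq by (auto simp: p'_def q'_def A_def)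
    have "commutator G y g = (y \<otimes> t \<otimes> inv y) \<otimes> inv t \<otimes> (t \<otimes> commutator G y x \<otimes> inv t)"
      using t x y by (simp add: gtx commutator_def inv_mult_group m_assoc cancel_inv)
    also have "t \<otimes> commutator G y x \<otimes> inv t = p' \<otimes> inv q'"
      using pqc t by (simp add: pq(3) p'_def q'_def inv_mult_group m_assoc cancel_inv)
    finally show ?thesis
      unfolding S_def using p'q' t y by (force simp: conj_class_def)
  qed
  ultimately show ?thesis by (auto intro: finite_subset[of _ S])
qed

section \<open>Central powers\<close>

text \<open>
  Among the conjugates of \<open>x\<close> by \<open>1, g, \<dots>, g\<^sup>m\<close> two coincide, so a power of
  \<open>g\<close> with exponent at most \<open>m\<close> commutes with \<open>x\<close>.
\<close>

lemma uniform_central_power: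
  assumes fin: "\<And>x. x \<in> carrier G \<Longrightarrow> finite (conj_class G x)"
    and bound: "\<And>x. x \<in> carrier G \<Longrightarrow> card (conj_class G x) \<le> m"
    and g: "g \<in> carrier G"
  shows "g [^] (fact m :: nat) \<in> center G"
proof -
  have "g [^] (fact m :: nat) \<otimes> x = x \<otimes> g [^] (fact m :: nat)" if x: "x \<in> carrier G" for x
  proof -
    define f where "f i = g [^] i \<otimes> x \<otimes> inv (g [^] i)" for i :: nat
    have "f ` {..m} \<subseteq> conj_class G x" using g by (auto simp: f_def conj_class_def)
    then have "card (f ` {..m}) \<le> m"
      using card_mono[OF fin[OF x]] bound[OF x] order_trans by blast
    then have "\<not> inj_on f {..m}" using pigeonhole[of f "{..m}"] by simp
    then obtain i j where ij: "i < j" "j \<le> m" "f i = f j"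
      by (auto simp: inj_on_def) (metis linorder_neqE_nat)
    define d where "d = j - i"
    have d: "0 < d" "d \<le> m" "j = i + d" using ij by (auto simp: d_def)
    define h where "h = g [^] d"
    define k where "k = g [^] i"
    have hk: "h \<in> carrier G" "k \<in> carrier G" using g by (auto simp: h_def k_def)
    have "g [^] j = k \<otimes> h" using g d by (simp add: k_def h_def nat_pow_mult)
    then have "k \<otimes> x \<otimes> inv k = (k \<otimes> h) \<otimes> x \<otimes> inv (k \<otimes> h)"
      using ij(3) by (simp add: f_def k_def)
    then have "inv k \<otimes> (k \<otimes> x \<otimes> inv k) \<otimes> k \<otimes> h =
        inv k \<otimes> ((k \<otimes> h) \<otimes> x \<otimes> inv (k \<otimes> h)) \<otimes> k \<otimes> h" by simp
    then have comm: "x \<otimes> h = h \<otimes> x"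
      using hk x by (simp add: m_assoc cancel_inv inv_mult_group)
    have "d dvd fact m" using d by (intro dvd_fact) auto
    then obtain c where "fact m = d * c" by (auto elim: dvdE)
    then have "g [^] (fact m :: nat) = h [^] c" using g by (simp add: h_def nat_pow_pow)
    moreover have "h [^] c \<otimes> x = x \<otimes> h [^] c"
    proof (induction c)
      case (Suc c)
      have "h [^] Suc c \<otimes> x = (h [^] c \<otimes> x) \<otimes> h" using hk x by (simp add: m_assoc comm)
      then show ?case using Suc hk x by (simp add: m_assoc)
    qed (use x in simp)
    ultimately show ?thesis by simp
  qed
  then show ?thesis using g by (simp add: center_def)
qed

section \<open>Finiteness of the derived subgroup\<close>

abbreviation mprod :: "'a list \<Rightarrow> 'a" where
  "mprod w \<equiv> foldr (\<otimes>) w \<one>"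

lemma mprod_append:
  assumes "set u \<subseteq> carrier G" "set v \<subseteq> carrier G"
  shows "mprod (u @ v) = mprod u \<otimes> mprod v"
  using assms by (induction u) (simp_all add: m_assoc)

lemma mprod_replicate:
  assumes "x \<in> carrier G"
  shows "mprod (replicate n x) = x [^] n"
  using assms by (induction n) (simp_all del: foldr_replicate flip: nat_pow_Suc2)

lemma conj_pow:
  assumes "x \<in> carrier G" "g \<in> carrier G"
  shows "(g \<otimes> x \<otimes> inv g) [^] (n::nat) = g \<otimes> x [^] n \<otimes> inv g"
  using assms by (induction n) (simp_all add: m_assoc cancel_inv)

text \<open>
  Moving a factor \<open>c\<close> to the front conjugates the factors that it passes, which stay in a
  set that is closed under conjugation; the number of factors does not change.
\<close>

lemma collect_factor:
  assumes K: "K \<subseteq> carrier G"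
    and conj: "\<And>g x. g \<in> carrier G \<Longrightarrow> x \<in> K \<Longrightarrow> g \<otimes> x \<otimes> inv g \<in> K"
    and c: "c \<in> K"
  shows "set w \<subseteq> K \<Longrightarrow> k \<le> count_list w c \<Longrightarrow>
    \<exists>v. set v \<subseteq> K \<and> length v + k = length w \<and> mprod w = c [^] k \<otimes> mprod v"
proof (induction w arbitrary: k)
  case Nil
  then show ?case by auto
next
  case (Cons x w)
  have cc: "c \<in> carrier G" and xc: "x \<in> carrier G" using c K Cons.prems by auto
  show ?case
  proof (cases "x = c \<and> k > 0")
    case True
    then obtain l where l: "k = Suc l" by (auto dest: gr0_implies_Suc)
    then obtain v where v: "set v \<subseteq> K" "length v + l = length w" "mprod w = c [^] l \<otimes> mprod v"
      using Cons.IH[of l] Cons.prems True by auto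
    have vc: "mprod v \<in> carrier G" using v K by (intro multlist_closed) auto
    have "mprod (x # w) = c [^] k \<otimes> mprod v"
      using True v cc vc unfolding l nat_pow_Suc2[OF cc] by (simp add: m_assoc)
    then show ?thesis using v l by auto
  next
    case False
    then have "k \<le> count_list w c" using Cons.prems by auto
    then obtain v where v: "set v \<subseteq> K" "length v + k = length w" "mprod w = c [^] k \<otimes> mprod v"
      using Cons.IH[of k] Cons.prems by auto
    have vc: "mprod v \<in> carrier G" using v K by (intro multlist_closed) auto
    define y where "y = inv (c [^] k) \<otimes> x \<otimes> inv (inv (c [^] k))"
    have y: "y \<in> K" unfolding y_def using cc Cons.prems by (intro conj) auto
    have "mprod (x # w) = c [^] k \<otimes> mprod (y # v)"
      using v cc vc xc by (simp add: y_def m_assoc cancel_inv)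
    then show ?thesis using v y by (intro exI[of _ "y # v"]) auto
  qed
qed

text \<open>
  Write \<open>c\<close> for the commutator of \<open>x\<close> and \<open>y\<close>. Since its power with
  exponent \<open>n + 1\<close> is central, it can be inserted after the first letter \<open>x\<close> of
  one more copy of \<open>c\<close>. The last of the inserted copies then merges with the rest of that copy
  into a single commutator, which turns \<open>n + 2\<close> commutators into \<open>n + 1\<close>.
\<close>

lemma shorten_commutator_power:
  assumes x: "x \<in> carrier G" and y: "y \<in> carrier G"
    and central: "commutator G x y [^] Suc n \<in> center G"
  shows "commutator G x y [^] Suc (Suc n) =
    (x \<otimes> commutator G x y \<otimes> inv x) [^] n \<otimes> commutator G (x \<otimes> x) y"
proof -
  let ?c = "commutator G x y"
  have c: "?c \<in> carrier G" using x y by simp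
  have "?c [^] Suc (Suc n) = ?c [^] Suc n \<otimes> x \<otimes> (y \<otimes> inv x \<otimes> inv y)"
    using x y c by (simp add: commutator_def m_assoc)
  also have "?c [^] Suc n \<otimes> x = x \<otimes> ?c [^] Suc n" using central x by (simp add: center_def)
  also have "\<dots> \<otimes> (y \<otimes> inv x \<otimes> inv y) = x \<otimes> ?c [^] n \<otimes> (?c \<otimes> (y \<otimes> inv x \<otimes> inv y))"
    using x y c by (simp add: m_assoc)
  also have "?c \<otimes> (y \<otimes> inv x \<otimes> inv y) = inv x \<otimes> commutator G (x \<otimes> x) y"
    using x y by (simp add: commutator_def m_assoc cancel_inv inv_mult_group)
  finally show ?thesis
    unfolding conj_pow[OF c x] using x y c by (simp add: m_assoc)
qed

lemma commutator_conj:
  assumes "x \<in> carrier G" "y \<in> carrier G" "g \<in> carrier G"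
  shows "g \<otimes> commutator G x y \<otimes> inv g =
    commutator G (g \<otimes> x \<otimes> inv g) (g \<otimes> y \<otimes> inv g)"
  using assms by (simp add: commutator_def inv_mult_group m_assoc cancel_inv)

text \<open>
  A shortest expression of an element of \<open>G'\<close> as a product of commutators contains each
  commutator at most \<open>n + 1\<close> times, since more copies could be collected and then replaced
  by fewer commutators. So its length is bounded, and there are only finitely many such expressions.
\<close>

lemma finite_derived:
  assumes finK: "finite {commutator G x y | x y. x \<in> carrier G \<and> y \<in> carrier G}"
    and central: "\<And>g. g \<in> carrier G \<Longrightarrow> g [^] Suc n \<in> center G"
  shows "finite (derived G (carrier G))"
proof -
  define K where "K = {commutator G x y | x y. x \<in> carrier G \<and> y \<in> carrier G}"
  have K: "K \<subseteq> carrier G" by (auto simp: K_def)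
  have finK: "finite K" using finK by (simp add: K_def)
  have conjK: "g \<otimes> x \<otimes> inv g \<in> K" if "g \<in> carrier G" "x \<in> K" for g x
    using that by (auto simp: K_def commutator_conj) (metis inv_closed m_closed)
  have invK: "inv x \<in> K" if x: "x \<in> K" for x
  proof -
    obtain u v where uv: "u \<in> carrier G" "v \<in> carrier G" "x = commutator G u v"
      using x by (auto simp: K_def)
    then have "inv x = commutator G v u" by (simp add: commutator_def inv_mult_group m_assoc)
    then show ?thesis using uv by (auto simp: K_def)
  qed
  have derived_generate: "derived G (carrier G) = generate G K"
    unfolding derived_def K_def commutator_def by (rule arg_cong[of _ _ "generate G"]) auto
  have product: "\<exists>w. set w \<subseteq> K \<and> g = mprod w" if "g \<in> generate G K" for g
    using that
  proof (induction rule: generate.induct)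
    case one
    then show ?case by (intro exI[of _ "[]"]) auto
  next
    case (incl h)
    then show ?case using K by (intro exI[of _ "[h]"]) auto
  next
    case (inv h)
    then show ?case using K invK by (intro exI[of _ "[inv h]"]) auto
  next
    case (eng h1 h2)
    then obtain u v where "set u \<subseteq> K" "h1 = mprod u" "set v \<subseteq> K" "h2 = mprod v" by auto
    then show ?case using K by (intro exI[of _ "u @ v"]) (auto simp: mprod_append simp del: foldr_append)
  qed
  define L where "L = (\<Sum>c\<in>K. Suc n)"
  have shorten: "\<exists>v. set v \<subseteq> K \<and> length v < length w \<and> mprod v = mprod w"
    if w: "set w \<subseteq> K" and long: "L < length w" for w
  proof -
    have "\<exists>c\<in>K. Suc n < count_list w c"
    proof (rule ccontr)
      assume "\<not> ?thesis"
      then have "(\<Sum>c\<in>K. count_list w c) \<le> L" unfolding L_def by (intro sum_mono) (auto simp: not_less)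
      then show False using sum_count_set[OF w finK] long by simp
    qed
    then obtain c where c: "c \<in> K" "Suc (Suc n) \<le> count_list w c" by auto
    obtain v where v: "set v \<subseteq> K" "length v + Suc (Suc n) = length w"
        "mprod w = c [^] Suc (Suc n) \<otimes> mprod v"
      using collect_factor[OF K conjK c(1) w c(2)] by auto
    obtain x y where xy: "x \<in> carrier G" "y \<in> carrier G" "c = commutator G x y"
      using c by (auto simp: K_def)
    define d where "d = x \<otimes> c \<otimes> inv x"
    have d: "d \<in> K" "d \<in> carrier G" using conjK xy c K by (auto simp: d_def)
    define e where "e = commutator G (x \<otimes> x) y"
    have e: "e \<in> K" "e \<in> carrier G" using xy by (auto simp: e_def K_def)
    have "c [^] Suc (Suc n) = d [^] n \<otimes> e"
      unfolding d_def e_def xy(3)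
      by (rule shorten_commutator_power) (use xy central in auto)
    moreover have "mprod (replicate n d @ e # v) = d [^] n \<otimes> (e \<otimes> mprod v)"
      using d e v K by (subst mprod_append) (auto simp: mprod_replicate simp del: foldr_replicate)
    moreover have "mprod v \<in> carrier G" using v K by (intro multlist_closed) auto
    ultimately have "mprod (replicate n d @ e # v) = mprod w"
      using v d e by (simp add: m_assoc)
    moreover have "set (replicate n d @ e # v) \<subseteq> K" using d e v by (auto simp: set_replicate_conv_if)
    moreover have "length (replicate n d @ e # v) < length w" using v by simp
    ultimately show ?thesis by blast
  qed
  have short: "\<exists>v. set v \<subseteq> K \<and> length v \<le> L \<and> mprod v = mprod w" if "set w \<subseteq> K" for w
    using that
  proof (induction w rule: measure_induct_rule[of length])
    case (less w)
    show ?case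
    proof (cases "length w \<le> L")
      case False
      then obtain v where "set v \<subseteq> K" "length v < length w" "mprod v = mprod w"
        using shorten[of w] less.prems by auto
      then show ?thesis using less.IH[of v] by auto
    qed (use less.prems in blast)
  qed
  have "generate G K \<subseteq> mprod ` {w. set w \<subseteq> K \<and> length w \<le> L}"
    using product short by (fastforce simp: image_iff)
  moreover have "finite {w. set w \<subseteq> K \<and> length w \<le> L}"
    using finK by (rule finite_lists_length_le)
  ultimately show ?thesis
    unfolding derived_generate by (meson finite_imageI finite_subset)
qed

section \<open>The torsion subgroup\<close>

lemma pow_mult_mod_derived:
  assumes x: "x \<in> carrier G" "x [^] (n::nat) = \<one>" and y: "y \<in> carrier G" "y [^] n = \<one>"
  shows "(x \<otimes> y) [^] n \<in> derived G (carrier G)"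
proof -
  let ?H = "derived G (carrier G)"
  interpret N: normal ?H G by (rule derived_self_is_normal)
  interpret Q: comm_group "G Mod ?H" by (rule derived_quot_is_comm_group)
  interpret h: group_hom G "G Mod ?H" "(#>) ?H"
    using N.r_coset_hom_Mod by unfold_locales
  have "?H #> ((x \<otimes> y) [^] n) =
      (?H #> x) [^]\<^bsub>G Mod ?H\<^esub> n \<otimes>\<^bsub>G Mod ?H\<^esub> (?H #> y) [^]\<^bsub>G Mod ?H\<^esub> n"
    using x(1) y(1) by (simp only: h.hom_nat_pow h.hom_mult h.hom_closed Q.nat_pow_distrib m_closed)
  also have "\<dots> = ?H #> (x [^] n \<otimes> y [^] n)"
    using x(1) y(1) by (simp only: h.hom_nat_pow h.hom_mult nat_pow_closed)
  also have "\<dots> = ?H" using x y N.subset by simp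
  finally show ?thesis
    using x y N.is_subgroup by (metis coset_join1 m_closed nat_pow_closed N.subset)
qed

lemma finite_subgroup_subset_Tor:
  assumes H: "subgroup H G" "finite H"
  shows "H \<subseteq> Tor G"
proof
  fix h assume h: "h \<in> H"
  interpret H: group "G\<lparr>carrier := H\<rparr>" using H(1) by (rule subgroup_imp_group)
  have "h [^] card H = \<one>"
    using H.pow_order_eq_1[of h] h by (simp add: order_def nat_pow_consistent[symmetric])
  moreover have "card H > 0" using H h by (auto simp: card_gt_0_iff)
  ultimately show "h \<in> Tor G" using h subgroup.subset[OF H(1)] by (auto simp: Tor_def)
qed

lemma normal_Tor:
  assumes "finite (derived G (carrier G))"
  shows "Tor G \<lhd> G"
proof -
  have derived_Tor: "derived G (carrier G) \<subseteq> Tor G"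
    using assms by (intro finite_subgroup_subset_Tor derived_is_subgroup) auto
  have "subgroup (Tor G) G"
  proof (rule subgroupI)
    show "Tor G \<subseteq> carrier G" by (auto simp: Tor_def)
    have "\<one> \<in> Tor G" by (auto simp: Tor_def intro!: exI[of _ 1])
    then show "Tor G \<noteq> {}" by blast
  next
    fix a assume "a \<in> Tor G"
    then show "inv a \<in> Tor G" by (auto simp: Tor_def nat_pow_inv)
  next
    fix a b assume "a \<in> Tor G" "b \<in> Tor G"
    then obtain i j :: nat where a: "a \<in> carrier G" "i > 0" "a [^] i = \<one>"
      and b: "b \<in> carrier G" "j > 0" "b [^] j = \<one>"
      by (auto simp: Tor_def)
    have "a [^] (i * j) = \<one>" "b [^] (j * i) = \<one>"
      using a b by (simp_all flip: nat_pow_pow)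
    then have "(a \<otimes> b) [^] (i * j) \<in> derived G (carrier G)"
      using a b by (intro pow_mult_mod_derived) (simp_all add: mult.commute)
    then obtain k :: nat where "k > 0" "((a \<otimes> b) [^] (i * j)) [^] k = \<one>"
      using derived_Tor by (auto simp: Tor_def)
    then show "a \<otimes> b \<in> Tor G"
      using a b by (auto simp: Tor_def nat_pow_pow intro!: exI[of _ "i * j * k"])
  qed
  moreover have "g \<otimes> x \<otimes> inv g \<in> Tor G" if "g \<in> carrier G" "x \<in> Tor G" for g x
    using that by (auto simp: Tor_def conj_pow)
  ultimately show ?thesis by (simp add: normal_inv_iff)
qed

section \<open>The divisible part of the center\<close>

lemma center_comm:
  assumes "x \<in> center G" "y \<in> carrier G"
  shows "x \<otimes> y = y \<otimes> x"
  using assms by (simp add: center_def)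

lemma center_carrier: "center G \<subseteq> carrier G"
  by (auto simp: center_def)

lemma center_pow: "x \<in> center G \<Longrightarrow> x [^] (n::nat) \<in> center G"
  using center_subgroup by (induction n) (auto simp: subgroup.one_closed subgroup.m_closed)

lemma center_pow_mult:
  assumes "x \<in> center G" "y \<in> carrier G"
  shows "(x \<otimes> y) [^] (n::nat) = x [^] n \<otimes> y [^] n"
  using assms center_carrier by (intro pow_mult_distrib center_comm) auto

lemma center_auto:
  assumes "\<phi> \<in> auto G" "z \<in> center G"
  shows "\<phi> z \<in> center G"
proof -
  interpret \<phi>: group_hom G G \<phi> using assms(1) by (rule auto_group_hom)
  have z: "z \<in> carrier G" using assms center_carrier by auto
  have "\<phi> z \<otimes> x = x \<otimes> \<phi> z" if "x \<in> carrier G" for x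
  proof -
    obtain u where "u \<in> carrier G" "x = \<phi> u"
      using \<open>x \<in> carrier G\<close> auto_bij_betw[OF assms(1)] by (auto simp: bij_betw_def)
    then show ?thesis using center_comm[OF assms(2)] z by (metis \<phi>.hom_mult)
  qed
  then show ?thesis using z by (simp add: center_def)
qed

lemma center_auto_iff:
  assumes "\<phi> \<in> auto G" "z \<in> carrier G"
  shows "\<phi> z \<in> center G \<longleftrightarrow> z \<in> center G"
proof
  interpret \<phi>: group_hom G G \<phi> using assms(1) by (rule auto_group_hom)
  assume c: "\<phi> z \<in> center G"
  have "z \<otimes> x = x \<otimes> z" if x: "x \<in> carrier G" for x
  proof -
    have "\<phi> (z \<otimes> x) = \<phi> (x \<otimes> z)" using center_comm[OF c] x assms by simp
    then show ?thesis
      using auto_bij_betw[OF assms(1)] x assms(2) by (auto simp: bij_betw_def inj_on_def)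
  qed
  then show "z \<in> center G" using assms by (simp add: center_def)
qed (use assms center_auto in blast)

lemma root_in_center_auto_iff:
  assumes "\<phi> \<in> auto G" "z \<in> carrier G"
  shows "(\<exists>y\<in>center G. \<phi> z = y [^] (n::nat)) \<longleftrightarrow> (\<exists>y\<in>center G. z = y [^] n)"
proof
  interpret \<phi>: group_hom G G \<phi> using assms(1) by (rule auto_group_hom)
  have b: "bij_betw \<phi> (carrier G) (carrier G)" using assms(1) by (rule auto_bij_betw)
  assume "\<exists>y\<in>center G. \<phi> z = y [^] n"
  then obtain y where y: "y \<in> center G" "\<phi> z = y [^] n" by blast
  then obtain u where u: "u \<in> carrier G" "y = \<phi> u"
    using b center_carrier by (auto simp: bij_betw_def)
  have "\<phi> z = \<phi> (u [^] n)" using y u by (simp add: \<phi>.hom_nat_pow)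
  then have "z = u [^] n" using b u assms(2) by (auto simp: bij_betw_def inj_on_def)
  then show "\<exists>y\<in>center G. z = y [^] n" using y u center_auto_iff[OF assms(1)] by auto
next
  interpret \<phi>: group_hom G G \<phi> using assms(1) by (rule auto_group_hom)
  assume "\<exists>y\<in>center G. z = y [^] n"
  then show "\<exists>y\<in>center G. \<phi> z = y [^] n"
    using center_auto[OF assms(1)] center_carrier \<phi>.hom_nat_pow by blast
qed

lemma subgroup_divisible_center: "subgroup (divisible_center G) G"
proof (rule subgroupI)
  show "divisible_center G \<subseteq> carrier G" using center_carrier by (auto simp: divisible_center_def)
  have "\<one> \<in> divisible_center G"
    using subgroup.one_closed[OF center_subgroup]
    by (auto simp: divisible_center_def intro!: bexI[of _ \<one>])
  then show "divisible_center G \<noteq> {}" by blast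
next
  fix a assume a: "a \<in> divisible_center G"
  have "\<exists>y\<in>center G. inv a = y [^] n" if n: "n > 0" for n :: nat
  proof -
    obtain y where "y \<in> center G" "a = y [^] n" using a n by (auto simp: divisible_center_def)
    then show ?thesis
      using center_carrier subgroup.m_inv_closed[OF center_subgroup]
      by (intro bexI[of _ "inv y"]) (auto simp: nat_pow_inv)
  qed
  then show "inv a \<in> divisible_center G"
    using a subgroup.m_inv_closed[OF center_subgroup] by (auto simp: divisible_center_def)
next
  fix a b assume a: "a \<in> divisible_center G" and b: "b \<in> divisible_center G"
  have "\<exists>y\<in>center G. a \<otimes> b = y [^] n" if n: "n > 0" for n :: nat
  proof -
    obtain y where y: "y \<in> center G" "a = y [^] n"
      using a n unfolding divisible_center_def by blast
    obtain z where z: "z \<in> center G" "b = z [^] n"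
      using b n unfolding divisible_center_def by blast
    from y z show ?thesis
      using center_carrier subgroup.m_closed[OF center_subgroup]
      by (intro bexI[of _ "y \<otimes> z"]) (auto simp: center_pow_mult)
  qed
  then show "a \<otimes> b \<in> divisible_center G"
    using a b subgroup.m_closed[OF center_subgroup] by (auto simp: divisible_center_def)
qed

lemma normal_divisible_center: "divisible_center G \<lhd> G"
proof -
  have "g \<otimes> z \<otimes> inv g = z" if "z \<in> divisible_center G" "g \<in> carrier G" for g z
  proof -
    have "z \<in> center G" "z \<in> carrier G"
      using that center_carrier by (auto simp: divisible_center_def)
    then have "g \<otimes> z \<otimes> inv g = z \<otimes> g \<otimes> inv g" using that center_comm by simp
    then show ?thesis using that \<open>z \<in> carrier G\<close> by (simp add: m_assoc)
  qed
  then show ?thesis using subgroup_divisible_center by (simp add: normal_inv_iff)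
qed

text \<open>
  Having roots of all orders in the center is expressed in terms of the group \<open>Z(G)\<close>
  alone, so it is preserved by all automorphisms of \<open>Z(G)\<close>, whether or not they extend to
  \<open>G\<close>. For the inclusion of \<open>D\<close> in its image the roots are pulled back along the
  automorphism.
\<close>

lemma characteristic_divisible_center:
  "characteristic_subgroup (divisible_center G) (G\<lparr>carrier := center G\<rparr>)"
proof -
  let ?Z = "G\<lparr>carrier := center G\<rparr>"
  let ?D = "divisible_center G"
  interpret Z: group ?Z using center_subgroup by (rule subgroup_imp_group)
  have pow: "x [^]\<^bsub>?Z\<^esub> n = x [^] n" for x and n :: nat
    by (rule nat_pow_consistent[symmetric])
  have D_Z: "?D = {z \<in> carrier ?Z. \<forall>n::nat. n > 0 \<longrightarrow> (\<exists>y\<in>carrier ?Z. z = y [^]\<^bsub>?Z\<^esub> n)}"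
    by (simp add: divisible_center_def pow)
  have "\<phi> ` ?D = ?D" if \<phi>: "\<phi> \<in> auto ?Z" for \<phi>
  proof -
    interpret \<phi>: group_hom ?Z ?Z \<phi> using \<phi> by (rule Z.auto_group_hom)
    have b: "bij_betw \<phi> (carrier ?Z) (carrier ?Z)" using \<phi> by (rule Z.auto_bij_betw)
    show ?thesis
    proof
      show "\<phi> ` ?D \<subseteq> ?D"
      proof
        fix w assume "w \<in> \<phi> ` ?D"
        then obtain z where z: "z \<in> ?D" "w = \<phi> z" by auto
        then have "z \<in> carrier ?Z" by (simp add: D_Z)
        moreover have "\<exists>y\<in>carrier ?Z. w = y [^]\<^bsub>?Z\<^esub> n" if n: "n > 0" for n :: nat
        proof -
          obtain y where "y \<in> carrier ?Z" "z = y [^]\<^bsub>?Z\<^esub> n" using z n unfolding D_Z by blast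
          then have "w = \<phi> y [^]\<^bsub>?Z\<^esub> n" "\<phi> y \<in> carrier ?Z"
            using z(2) \<phi>.hom_nat_pow \<phi>.hom_closed by blast+
          then show ?thesis by blast
        qed
        ultimately show "w \<in> ?D" using z(2) \<phi>.hom_closed unfolding D_Z by blast
      qed
    next
      show "?D \<subseteq> \<phi> ` ?D"
      proof
        fix w assume w: "w \<in> ?D"
        then have "w \<in> \<phi> ` carrier ?Z" using b unfolding D_Z bij_betw_def by blast
        then obtain z where z: "z \<in> carrier ?Z" "w = \<phi> z" by blast
        have "\<exists>y\<in>carrier ?Z. z = y [^]\<^bsub>?Z\<^esub> n" if n: "n > 0" for n :: nat
        proof -
          obtain u where u: "u \<in> carrier ?Z" "w = u [^]\<^bsub>?Z\<^esub> n" using w n unfolding D_Z by blast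
          then have "u \<in> \<phi> ` carrier ?Z" using b unfolding bij_betw_def by blast
          then obtain y where y: "y \<in> carrier ?Z" "u = \<phi> y" by blast
          then have "\<phi> z = \<phi> (y [^]\<^bsub>?Z\<^esub> n)" using u z \<phi>.hom_nat_pow by metis
          then have "z = y [^]\<^bsub>?Z\<^esub> n"
            using b z y Z.nat_pow_closed unfolding bij_betw_def inj_on_def by blast
          then show ?thesis using y by blast
        qed
        then show "w \<in> \<phi> ` ?D" using z unfolding D_Z by blast
      qed
    qed
  qed
  moreover have "subgroup ?D ?Z"
    using subgroup_divisible_center center_subgroup
    by (rule subgroup_incl) (auto simp: divisible_center_def)
  ultimately show ?thesis by (simp add: characteristic_subgroup_def)
qed

lemma divisible_carrier_update_iff:
  "divisible (G\<lparr>carrier := H\<rparr>) \<longleftrightarrow> (\<forall>n::nat. n > 0 \<longrightarrow> (\<forall>x\<in>H. \<exists>y\<in>H. y [^] n = x))"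
  by (simp add: divisible_def nat_pow_consistent[symmetric])

text \<open>
  An \<open>n\<close>-th root in the center need not lie in \<open>D\<close>. But a central
  \<open>k n\<close>-th root has its \<open>k\<close>-th power in \<open>D\<close>, and that power is an
  \<open>n\<close>-th root.
\<close>

lemma divisible_divisible_center:
  assumes k: "k > 0" "\<And>z. z \<in> center G \<Longrightarrow> z [^] (k::nat) \<in> divisible_center G"
  shows "divisible (G\<lparr>carrier := divisible_center G\<rparr>)"
proof -
  have "\<exists>y\<in>divisible_center G. y [^] n = z"
    if n: "n > 0" and z: "z \<in> divisible_center G" for n :: nat and z
  proof -
    have "k * n > 0" using n k(1) by simp
    then obtain y where y: "y \<in> center G" "z = y [^] (k * n)"
      using z unfolding divisible_center_def by blast
    then have "(y [^] k) [^] n = z" using center_carrier by (auto simp: nat_pow_pow)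
    then show ?thesis using k(2) y by blast
  qed
  then show ?thesis by (simp add: divisible_carrier_update_iff)
qed

text \<open>
  A torsion element of \<open>D\<close> is an \<open>e\<close>-th power of a central element, and that root
  is again a torsion element, whose \<open>e\<close>-th power is trivial.
\<close>

lemma Tor_Int_divisible_center:
  assumes e: "e > 0" "\<And>x. x \<in> Tor G \<Longrightarrow> x [^] (e::nat) = \<one>"
  shows "Tor G \<inter> divisible_center G = {\<one>}"
proof
  show "Tor G \<inter> divisible_center G \<subseteq> {\<one>}"
  proof clarify
    fix z assume z: "z \<in> Tor G" "z \<in> divisible_center G"
    obtain y where y: "y \<in> center G" "z = y [^] e" using z e by (auto simp: divisible_center_def)
    obtain i :: nat where i: "i > 0" "z [^] i = \<one>" using z by (auto simp: Tor_def)
    have "y [^] (e * i) = \<one>" using y i center_carrier by (auto simp flip: nat_pow_pow)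
    then have "y \<in> Tor G" using y i e center_carrier by (auto simp: Tor_def intro!: exI[of _ "e * i"])
    then show "z = \<one>" using e y by simp
  qed
  show "{\<one>} \<subseteq> Tor G \<inter> divisible_center G"
    using subgroup.one_closed[OF subgroup_divisible_center]
    by (auto simp: Tor_def intro!: exI[of _ 1])
qed

lemma Tor_mult_divisible_center:
  assumes M: "M > 0" "\<And>g. g \<in> carrier G \<Longrightarrow> g [^] (M::nat) \<in> divisible_center G"
    and div: "divisible (G\<lparr>carrier := divisible_center G\<rparr>)"
  shows "Tor G <#> divisible_center G = carrier G"
proof
  show "Tor G <#> divisible_center G \<subseteq> carrier G"
    using subgroup.subset[OF subgroup_divisible_center] by (auto simp: set_mult_def Tor_def)
  show "carrier G \<subseteq> Tor G <#> divisible_center G"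
  proof
    fix g assume g: "g \<in> carrier G"
    obtain d where d: "d \<in> divisible_center G" "d [^] M = g [^] M"
      using div M(1) M(2)[OF g] unfolding divisible_carrier_update_iff by blast
    have dz: "inv d \<in> center G" "d \<in> carrier G"
      using d center_carrier subgroup.m_inv_closed[OF center_subgroup]
      by (auto simp: divisible_center_def)
    define t where "t = inv d \<otimes> g"
    have "t [^] M = inv (d [^] M) \<otimes> g [^] M"
      using dz g by (simp add: t_def center_pow_mult nat_pow_inv)
    then have "t \<in> Tor G" using d g dz M by (auto simp: Tor_def t_def)
    moreover have "g = t \<otimes> d"
      using dz g center_comm[OF dz(1) g] by (simp add: t_def m_assoc)
    ultimately show "g \<in> Tor G <#> divisible_center G" using d by (auto simp: set_mult_def)
  qed
qed

section \<open>The decomposition\<close>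

lemma Tor_exponent:
  assumes "finite (automorphism_orbits G)"
  obtains e :: nat where "e > 0" "\<And>x. x \<in> Tor G \<Longrightarrow> x [^] e = \<one>"
proof -
  have inv: "\<phi> x [^] n = \<one>" if "\<phi> \<in> auto G" "x \<in> carrier G" "x [^] n = \<one>" for \<phi> x and n :: nat
  proof -
    interpret \<phi>: group_hom G G \<phi> using that(1) by (rule auto_group_hom)
    show ?thesis using that \<phi>.hom_nat_pow \<phi>.hom_one by metis
  qed
  have "\<exists>e>0::nat. \<forall>x\<in>carrier G. \<forall>n>0. x [^] (n::nat) = \<one> \<longrightarrow>
      (\<exists>k>0. x [^] k = \<one> \<and> k dvd e)"
    by (rule uniform_multiple[of "\<lambda>x n. x [^] n = \<one>", OF assms]) (rule inv)
  then obtain e :: nat where e: "e > 0"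
    "\<And>x n. x \<in> carrier G \<Longrightarrow> n > 0 \<Longrightarrow> x [^] (n::nat) = \<one> \<Longrightarrow> \<exists>k>0. x [^] k = \<one> \<and> k dvd e"
    by blast
  have "x [^] e = \<one>" if x: "x \<in> Tor G" for x
  proof -
    obtain n :: nat where "x \<in> carrier G" "n > 0" "x [^] n = \<one>"
      using x by (auto simp: Tor_def)
    then obtain k where "x \<in> carrier G" "x [^] k = \<one>" "k dvd e" using e(2) by blast
    then show ?thesis by (auto simp flip: nat_pow_pow elim!: dvdE)
  qed
  then show ?thesis using that e(1) by blast
qed

text \<open>
  Uniformity is applied to the orders \<open>n\<close> for which \<open>z\<close> has no \<open>n\<close>-th
  root in the center: \<open>k\<close> is chosen so that every \<open>z\<close> with such an order has one
  that divides \<open>k\<close>. A \<open>k\<close>-th power has roots of all orders that divide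
  \<open>k\<close>, so it has roots of all orders.
\<close>

lemma divisible_power:
  assumes "finite (automorphism_orbits G)"
  obtains k :: nat where "k > 0" "\<And>z. z \<in> center G \<Longrightarrow> z [^] k \<in> divisible_center G"
proof -
  have inv: "\<not> (\<exists>y\<in>center G. \<phi> z = y [^] n)"
    if "\<phi> \<in> auto G" "z \<in> carrier G" "\<not> (\<exists>y\<in>center G. z = y [^] n)" for \<phi> z and n :: nat
    using that by (simp only: root_in_center_auto_iff) simp
  have "\<exists>k>0::nat. \<forall>z\<in>carrier G. \<forall>n>0. \<not> (\<exists>y\<in>center G. z = y [^] (n::nat)) \<longrightarrow>
      (\<exists>i>0. \<not> (\<exists>y\<in>center G. z = y [^] i) \<and> i dvd k)"
    by (rule uniform_multiple[of "\<lambda>z n. \<not> (\<exists>y\<in>center G. z = y [^] n)", OF assms]) (rule inv)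
  then obtain k :: nat where k: "k > 0"
    "\<And>z n. z \<in> carrier G \<Longrightarrow> n > 0 \<Longrightarrow> \<not> (\<exists>y\<in>center G. z = y [^] (n::nat)) \<Longrightarrow>
       \<exists>i>0. \<not> (\<exists>y\<in>center G. z = y [^] i) \<and> i dvd k"
    by metis
  have "z [^] k \<in> divisible_center G" if z: "z \<in> center G" for z
  proof -
    have zc: "z \<in> carrier G" using z center_carrier by auto
    have "\<exists>y\<in>center G. z [^] k = y [^] i" if "i dvd k" for i
    proof -
      obtain j where "k = j * i" using \<open>i dvd k\<close> by (metis dvdE mult.commute)
      then have "z [^] k = (z [^] j) [^] i" using zc by (simp add: nat_pow_pow)
      then show ?thesis using z center_pow by blast
    qed
    then have "\<exists>y\<in>center G. z [^] k = y [^] n" if "n > 0" for n :: nat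
      using k(2)[of "z [^] k" n] zc that by blast
    then show ?thesis using z center_pow by (simp add: divisible_center_def)
  qed
  then show ?thesis using that k(1) by blast
qed

lemma conj_class_bound:
  assumes orb: "finite (automorphism_orbits G)"
  obtains m where "\<And>x. x \<in> carrier G \<Longrightarrow> card (conj_class G x) \<le> m"
proof -
  have "\<exists>m>0. \<forall>x\<in>carrier G. \<forall>n>0. card (conj_class G x) = n \<longrightarrow>
      (\<exists>k>0. card (conj_class G x) = k \<and> k dvd m)"
    using orb by (rule uniform_multiple) (simp add: card_conj_class_auto)
  then obtain m where m: "m > 0"
    "\<And>x. x \<in> carrier G \<Longrightarrow> card (conj_class G x) > 0 \<Longrightarrow> card (conj_class G x) dvd m"
    by blast
  have "card (conj_class G x) \<le> m" if "x \<in> carrier G" for x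
  proof (cases "card (conj_class G x) > 0")
    case True
    then show ?thesis using m that by (metis dvd_imp_le)
  qed simp
  then show ?thesis using that by blast
qed

end

lemma (in fc_group) finite_conj_class:
  assumes "x \<in> carrier G"
  shows "finite (conj_class G x)"
proof -
  have "orbit G (\<lambda>g. \<lambda>h \<in> carrier G. g \<otimes> h \<otimes> inv g) x = conj_class G x"
    using assms by (auto simp: orbit_def conj_class_def)
  then show ?thesis using finite_conjugates[OF assms] by simp
qed

lemma (in fc_group) derived_finite_and_decomposition:
  assumes orb: "finite (automorphism_orbits G)"
  shows "finite (derived G (carrier G))"
    and "internal_direct_product G (Tor G) (divisible_center G)"
    and "divisible (G\<lparr>carrier := divisible_center G\<rparr>)"
proof -
  obtain m where m: "\<And>x. x \<in> carrier G \<Longrightarrow> card (conj_class G x) \<le> m"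
    using conj_class_bound[OF orb] by blast
  have central: "g [^] (fact m :: nat) \<in> center G" if "g \<in> carrier G" for g
    using finite_conj_class m that by (rule uniform_central_power)
  obtain n where n: "fact m = Suc n" using fact_gt_zero[of m] gr0_implies_Suc by blast
  have derived: "finite (derived G (carrier G))"
  proof (rule finite_derived)
    show "finite {commutator G x y | x y. x \<in> carrier G \<and> y \<in> carrier G}"
      using finite_conj_class m by (rule finite_commutators)
    show "g [^] Suc n \<in> center G" if "g \<in> carrier G" for g
      using central[OF that] n by simp
  qed
  obtain e :: nat where e: "e > 0" "\<And>x. x \<in> Tor G \<Longrightarrow> x [^] e = \<one>"
    using Tor_exponent[OF orb] by blast
  obtain k :: nat where k: "k > 0" "\<And>z. z \<in> center G \<Longrightarrow> z [^] k \<in> divisible_center G"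
    using divisible_power[OF orb] by blast
  have div: "divisible (G\<lparr>carrier := divisible_center G\<rparr>)"
    using k by (rule divisible_divisible_center)
  have "Tor G <#> divisible_center G = carrier G"
  proof (rule Tor_mult_divisible_center[OF _ _ div])
    show "(fact m :: nat) * k > 0" using k by simp
    show "g [^] ((fact m :: nat) * k) \<in> divisible_center G" if "g \<in> carrier G" for g
      using k(2)[OF central[OF that]] that by (simp add: nat_pow_pow)
  qed
  then show "internal_direct_product G (Tor G) (divisible_center G)"
    using normal_Tor[OF derived] normal_divisible_center Tor_Int_divisible_center[OF e]
    by (simp add: internal_direct_product_def)
  show "finite (derived G (carrier G))" "divisible (G\<lparr>carrier := divisible_center G\<rparr>)"
    by (fact derived div)+
qed

theorem theoremA:
  fixes G :: "('a, 'b) monoid_scheme"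
  assumes "fc_group G"
    and "infinite (carrier G)"
    and "finite (automorphism_orbits G)"
  shows "finite (derived G (carrier G)) \<and>
    (\<exists>D. internal_direct_product G (Tor G) D \<and>
         characteristic_subgroup D (G\<lparr>carrier := center G\<rparr>) \<and>
         divisible (G\<lparr>carrier := D\<rparr>))"
proof -
  interpret fc_group G by fact
  show ?thesis
    using derived_finite_and_decomposition[OF assms(3)] characteristic_divisible_center by blast
qed

end
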